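(* Let $n = 2^r$ for some positive integer $r$ and let $m$ be a positive integer with $n/2 < m < n$. Let $Y_{r-1} = [\mathbf{y}_1,\ldots,\mathbf{y}_{n/2}] \in \mathbb{C}^{(n/2)\times(n/2)}$ be the Walsh matrix of order $r-1$ with columns $\mathbf{y}_j$. Let $s = m - n/2$, let $1 \leq k(1) < \cdots < k(s) \leq n/2$ be an arbitrary selection of $s$ indices from $\{1,\ldots,n/2\}$, and define $$Y_a = [\mathbf{y}_1,\ldots,\mathbf{y}_{n/2} \mid \mathbf{y}_{k(1)},\ldots,\mathbf{y}_{k(s)}],\qquad Y_b = [\mathbf{y}_1,\ldots,\mathbf{y}_{n/2} \mid -\mathbf{y}_{k(1)},\ldots,-\mathbf{y}_{k(s)}]$$ in $\mathbb{C}^{(n/2)\times m}$, and $$Y = \begin{bmatrix} Y_a \\ Y_b\end{bmatrix} \in \mathbb{C}^{n\times m}.$$ Let $V = Y^*/\sqrt{n} \in \mathbb{C}^{m\times n}$, $V_a = Y_a^*/\sqrt{n}$ and $V_b = Y_b^*/\sqrt{n}$, so that $V = [V_a \mid V_b]$. Let $\Delta = [\mathbf{e}_{k(1)},\ldots,\mathbf{e}_{k(s)}] \in \mathbb{C}^{(n/2)\times s}$, where $\mathbf{e}_1,\ldots,\mathbf{e}_{n/2}$ is the standard basis of $\mathbb{C}^{n/2}$, and let $I = I_m$ be the $m\times m$ identity matrix. Then: 1. $VV^* = I$. 2. $$V_aV_a^* - \tfrac12 I = \begin{bmatrix} 0 & \Delta/2 \\ \Delta^*/2 & 0\end{bmatrix},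 \qquad V_bV_b^* - \tfrac12 I = \begin{bmatrix} 0 & -\Delta/2 \\ -\Delta^*/2 & 0\end{bmatrix}.$$ 3. $\|V_aV_a^* - \tfrac12 I\|_2 = \|V_bV_b^* - \tfrac12 I\|_2 = \tfrac12$, and this error is the best possible: writing $V = [\mathbf{v}_1,\ldots,\mathbf{v}_n]$, for every partition of $\{1,\ldots,n\}$ into two disjoint subsets $\mathcal{J}_1,\mathcal{J}_2$ one has $\max_{k=1,2}\left\|\sum_{j\in\mathcal{J}_k}\mathbf{v}_j\mathbf{v}_j^* - \tfrac12 I\right\|_2 \geq \tfrac12$. 4. $\|V_aV_a^*\|_2 = \|V_bV_b^*\|_2 = 1$. 5. In the Frobenius norm, $$\|V_aV_a^* - \tfrac12 I\|_F = \|V_bV_b^* - \tfrac12 I\|_F = \sqrt{s/2} = \sqrt{(m-n/2)/2}$$ and $$\|V_aV_a^*\|_F = \|V_bV_b^*\|_F = \sqrt{(m+2s)/4} = \sqrt{(3m-n)/4}.$$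
   Context: The Walsh matrices (natural ordering, Sylvester construction) are defined recursively by $Y_0 = [1]$ and $Y_r = \begin{bmatrix} Y_{r-1} & Y_{r-1} \\ Y_{r-1} & -Y_{r-1}\end{bmatrix}$ for $r \geq 1$, so $Y_r$ is a $2^r \times 2^r$ matrix with entries $\pm 1$. Here $^*$ denotes conjugate transpose, $\|\cdot\|_2$ is the spectral norm (the operator norm induced by the Euclidean norm), and $\|\cdot\|_F$ is the Frobenius norm. The block decompositions of $m\times m$ matrices correspond to $m = n/2 + s$. *)

theory Defs
  imports "Jordan_Normal_Form.Schur_Decomposition" "HOL-Analysis.L2_Norm"
begin

text \<open>All indices are 0-based: the mathematical index \<open>j \<in> {1..N}\<close> is rendered as
  \<open>j - 1 \<in> {..<N}\<close>. The conjugate transpose is the library's \<^const>\<open>mat_adjoint\<close>.\<close>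

fun walsh :: "nat \<Rightarrow> complex mat" where
  "walsh 0 = mat 1 1 (\<lambda>_. 1)"
| "walsh (Suc r) = four_block_mat (walsh r) (walsh r) (walsh r) (- walsh r)"

definition outer_prod :: "complex vec \<Rightarrow> complex vec \<Rightarrow> complex mat" where
  "outer_prod v w = mat (dim_vec v) (dim_vec w) (\<lambda>(i, j). v $ i * cnj (w $ j))"

definition euclid_norm :: "complex vec \<Rightarrow> real" where
  "euclid_norm v = L2_set (\<lambda>i. cmod (v $ i)) {..<dim_vec v}"

text \<open>The supremum is over the closed unit ball rather than the unit sphere, so that the set is
  nonempty also for matrices without columns. It is bounded, see \<open>spectral_norm_bdd_above\<close>.\<close>

definition spectral_norm :: "complex mat \<Rightarrow> real" where
  "spectral_norm A =
     (SUP x \<in> {x \<in> carrier_vec (dim_col A). euclid_norm x \<le> 1}. euclid_norm (A *\<^sub>v x))"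

definition frobenius_norm :: "complex mat \<Rightarrow> real" where
  "frobenius_norm A =
     sqrt (\<Sum>i<dim_row A. \<Sum>j<dim_col A. (cmod (A $$ (i, j)))\<^sup>2)"

lemma spectral_norm_bdd_above:
  "bdd_above ((\<lambda>x. euclid_norm (A *\<^sub>v x)) ` {x \<in> carrier_vec (dim_col A). euclid_norm x \<le> 1})"
proof (rule bdd_aboveI2)
  fix x assume "x \<in> {x \<in> carrier_vec (dim_col A). euclid_norm x \<le> 1}"
  then have dx: "dim_vec x = dim_col A" and nx: "euclid_norm x \<le> 1" by auto
  have x1: "cmod (x $ j) \<le> 1" if "j < dim_col A" for j
  proof -
    have "cmod (x $ j) \<le> L2_set (\<lambda>i. cmod (x $ i)) {..<dim_vec x}"
      using that dx by (intro member_le_L2_set) auto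
    then show ?thesis using nx unfolding euclid_norm_def by simp
  qed
  have "euclid_norm (A *\<^sub>v x) \<le> (\<Sum>i<dim_row A. cmod ((A *\<^sub>v x) $ i))"
    unfolding euclid_norm_def by (rule order_trans[OF L2_set_le_sum]) auto
  also have "\<dots> \<le> (\<Sum>i<dim_row A. \<Sum>j<dim_col A. cmod (A $$ (i, j)))"
  proof (rule sum_mono)
    fix i assume i: "i \<in> {..<dim_row A}"
    have "cmod ((A *\<^sub>v x) $ i) = cmod (\<Sum>j<dim_col A. A $$ (i, j) * x $ j)"
      using i dx by (simp add: scalar_prod_def atLeast0LessThan)
    also have "\<dots> \<le> (\<Sum>j<dim_col A. cmod (A $$ (i, j) * x $ j))"
      by (rule norm_sum)
    also have "\<dots> \<le> (\<Sum>j<dim_col A. cmod (A $$ (i, j)))"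
      using x1 by (intro sum_mono) (auto simp: norm_mult intro!: mult_left_le)
    finally show "cmod ((A *\<^sub>v x) $ i) \<le> (\<Sum>j<dim_col A. cmod (A $$ (i, j)))" .
  qed
  finally show "euclid_norm (A *\<^sub>v x) \<le> (\<Sum>i<dim_row A. \<Sum>j<dim_col A. cmod (A $$ (i, j)))" .
qed

end

theory Submission
  imports Defs
begin

text \<open>The columns of a Walsh matrix of size \<open>h = n/2\<close> are orthogonal with squared norm \<open>h\<close>. The
  entries of \<open>V\<^sub>a V\<^sub>a\<^sup>*\<close> and \<open>V\<^sub>b V\<^sub>b\<^sup>*\<close> are inner products of columns of \<open>Y\<^sub>a\<close> and \<open>Y\<^sub>b\<close> divided by
  \<open>n = 2 h\<close>. They are \<open>1/2\<close> on the diagonal, \<open>1/2\<close> respectively \<open>-1/2\<close> between a column and its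
  repetition, and zero elsewhere (\<open>Gram_extended_cols\<close>). Both matrices are thus instances of
  one block matrix, \<open>coupling_mat\<close>, with opposite couplings.

  The opposite couplings cancel in \<open>V V\<^sup>* = V\<^sub>a V\<^sub>a\<^sup>* + V\<^sub>b V\<^sub>b\<^sup>* = I\<close>. Subtracting \<open>I/2\<close> removes the
  diagonal. The Frobenius norms follow by counting entries. The spectral norm is the sum of the moduli
  of the diagonal and the coupling entry: the Schur test bounds it from above, and an eigenvector
  supported on one column index and its repetition attains the bound
  (\<open>spectral_norm_coupling_mat\<close>).

  That \<open>1/2\<close> is optimal is a rank argument and holds for any family of \<open>n < 2 m\<close> vectors: one of the
  two parts has fewer than \<open>m\<close> vectors, so its sum of rank-one matrices is singular, and \<open>-1/2\<close> is an
  eigenvalue after subtracting \<open>I/2\<close> (\<open>spectral_norm_few_outer_prods_minus_scalar_ge\<close>).\<close>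

section \<open>Finite sums and adjoints\<close>

lemma sum_lessThan_add:
  fixes f :: "nat \<Rightarrow> 'a::comm_monoid_add"
  shows "(\<Sum>i<a + b. f i) = (\<Sum>i<a. f i) + (\<Sum>i<b. f (a + i))"
  by (induction b) (simp_all add: add.assoc)

lemma dim_mat_adjoint [simp]:
  "dim_row (mat_adjoint A) = dim_col A" "dim_col (mat_adjoint A) = dim_row A"
  by (simp_all add: mat_adjoint_def)

lemma index_mat_adjoint [simp]:
  fixes A :: "complex mat"
  assumes "i < dim_col A" "j < dim_row A"
  shows "mat_adjoint A $$ (i, j) = cnj (A $$ (j, i))"
  using assms by (simp add: mat_adjoint_def mat_of_rows_index)

lemma index_mult_adjoint:
  fixes A :: "complex mat"
  assumes "i < dim_row A" "j < dim_row A"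
  shows "(A * mat_adjoint A) $$ (i, j) = (\<Sum>l<dim_col A. A $$ (i, l) * cnj (A $$ (j, l)))"
  using assms by (simp add: scalar_prod_def atLeast0LessThan)

lemma index_mult_mat_vec_sum:
  assumes "i < dim_row A" "dim_vec x = dim_col A"
  shows "(A *\<^sub>v x) $ i = (\<Sum>j<dim_col A. A $$ (i, j) * x $ j)"
  using assms by (simp add: scalar_prod_def atLeast0LessThan)

section \<open>Euclidean and spectral norm\<close>

lemma euclid_norm_smult: "euclid_norm (c \<cdot>\<^sub>v x) = cmod c * euclid_norm x"
  unfolding euclid_norm_def
  by (subst L2_set_right_distrib) (auto intro!: L2_set_cong simp: norm_mult)

lemma euclid_norm_pos:
  assumes "x \<in> carrier_vec n" "x \<noteq> 0\<^sub>v n"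
  shows "0 < euclid_norm x"
proof -
  obtain i where "i < n" "x $ i \<noteq> 0"
    using assms by (metis carrier_vecD eq_vecI index_zero_vec(1,2))
  then have "euclid_norm x \<noteq> 0"
    using assms(1) by (auto simp: euclid_norm_def L2_set_eq_0_iff)
  moreover have "0 \<le> euclid_norm x" by (simp add: euclid_norm_def)
  ultimately show ?thesis by simp
qed

text \<open>An eigenvector scaled to norm one lies in the unit ball over which the supremum is taken,
  so every eigenvalue is a lower bound for the norm.\<close>

lemma eigenvalue_le_spectral_norm:
  assumes A: "A \<in> carrier_mat n n" and x: "x \<in> carrier_vec n" "x \<noteq> 0\<^sub>v n"
    and eig: "A *\<^sub>v x = c \<cdot>\<^sub>v x"
  shows "cmod c \<le> spectral_norm A"
proof -
  define t where "t = complex_of_real (1 / euclid_norm x)"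
  have pos: "0 < euclid_norm x" using euclid_norm_pos[OF x] .
  then have unit: "euclid_norm (t \<cdot>\<^sub>v x) = 1"
    by (simp add: euclid_norm_smult t_def norm_divide)
  have "A *\<^sub>v (t \<cdot>\<^sub>v x) = c \<cdot>\<^sub>v (t \<cdot>\<^sub>v x)"
    using A x(1) eig by (simp add: smult_smult_assoc mult.commute mult_mat_vec)
  then have "cmod c = euclid_norm (A *\<^sub>v (t \<cdot>\<^sub>v x))"
    using unit by (simp only: euclid_norm_smult)
  also have "\<dots> \<le> spectral_norm A"
    unfolding spectral_norm_def
    using A x(1) unit by (intro cSUP_upper[OF _ spectral_norm_bdd_above]) auto
  finally show ?thesis .
qed

text \<open>The Schur test. Splitting each \<open>\<bar>a\<^sub>i\<^sub>j\<bar>\<close> into two square roots, Cauchy--Schwarz bounds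
  \<open>\<bar>(A x)\<^sub>i\<bar>\<^sup>2\<close> by the \<open>i\<close>-th absolute row sum times \<open>\<Sum>\<^sub>j \<bar>a\<^sub>i\<^sub>j\<bar> \<bar>x\<^sub>j\<bar>\<^sup>2\<close>; summing over \<open>i\<close>
  turns the second factor into absolute column sums.\<close>

lemma spectral_norm_le_Schur:
  assumes row: "\<And>i. i < dim_row A \<Longrightarrow> (\<Sum>j<dim_col A. cmod (A $$ (i, j))) \<le> c"
    and col: "\<And>j. j < dim_col A \<Longrightarrow> (\<Sum>i<dim_row A. cmod (A $$ (i, j))) \<le> c"
    and c: "0 \<le> c"
  shows "spectral_norm A \<le> c"
  unfolding spectral_norm_def
proof (rule cSUP_least)
  show "{x \<in> carrier_vec (dim_col A). euclid_norm x \<le> 1} \<noteq> {}"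
    by (auto intro!: exI[of _ "0\<^sub>v (dim_col A)"] simp: euclid_norm_def L2_set_def)
next
  fix x assume "x \<in> {x \<in> carrier_vec (dim_col A). euclid_norm x \<le> 1}"
  then have dx: "dim_vec x = dim_col A" and nx: "euclid_norm x \<le> 1" by auto
  have sq: "(L2_set f B)\<^sup>2 = (\<Sum>i\<in>B. (f i)\<^sup>2)" for f and B :: "nat set"
    by (simp add: L2_set_def sum_nonneg)
  let ?a = "\<lambda>i j. cmod (A $$ (i, j))"
  have entry: "(cmod ((A *\<^sub>v x) $ i))\<^sup>2 \<le> c * (\<Sum>j<dim_col A. ?a i j * (cmod (x $ j))\<^sup>2)"
    if i: "i < dim_row A" for i
  proof -
    have "cmod ((A *\<^sub>v x) $ i) \<le> (\<Sum>j<dim_col A. ?a i j * cmod (x $ j))"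
      unfolding index_mult_mat_vec_sum[OF i dx]
      by (rule order_trans[OF norm_sum]) (simp add: norm_mult)
    also have "\<dots> = (\<Sum>j<dim_col A. \<bar>sqrt (?a i j)\<bar> * \<bar>sqrt (?a i j) * cmod (x $ j)\<bar>)"
      by (intro sum.cong refl) (simp add: abs_mult flip: mult.assoc)
    also have "\<dots> \<le> L2_set (\<lambda>j. sqrt (?a i j)) {..<dim_col A}
        * L2_set (\<lambda>j. sqrt (?a i j) * cmod (x $ j)) {..<dim_col A}"
      by (rule L2_set_mult_ineq)
    finally have "(cmod ((A *\<^sub>v x) $ i))\<^sup>2 \<le> (\<dots>)\<^sup>2"
      by (intro power_mono) auto
    also have "\<dots> = (\<Sum>j<dim_col A. ?a i j) * (\<Sum>j<dim_col A. ?a i j * (cmod (x $ j))\<^sup>2)"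
      by (simp add: power_mult_distrib sq)
    also have "\<dots> \<le> c * (\<Sum>j<dim_col A. ?a i j * (cmod (x $ j))\<^sup>2)"
      by (intro mult_right_mono row[OF i] sum_nonneg) auto
    finally show ?thesis .
  qed
  have "(euclid_norm (A *\<^sub>v x))\<^sup>2 = (\<Sum>i<dim_row A. (cmod ((A *\<^sub>v x) $ i))\<^sup>2)"
    by (simp add: euclid_norm_def sq)
  also have "\<dots> \<le> (\<Sum>i<dim_row A. c * (\<Sum>j<dim_col A. ?a i j * (cmod (x $ j))\<^sup>2))"
    by (intro sum_mono entry) auto
  also have "\<dots> = c * (\<Sum>j<dim_col A. (\<Sum>i<dim_row A. ?a i j) * (cmod (x $ j))\<^sup>2)"
    unfolding sum_distrib_left[symmetric] sum_distrib_right by (subst sum.swap) simp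
  also have "\<dots> \<le> c * (\<Sum>j<dim_col A. c * (cmod (x $ j))\<^sup>2)"
    using c by (intro mult_left_mono sum_mono mult_right_mono col) auto
  also have "\<dots> = c\<^sup>2 * (euclid_norm x)\<^sup>2"
    by (simp add: euclid_norm_def sq dx power2_eq_square[of c] mult.assoc flip: sum_distrib_left)
  also have "\<dots> = (c * euclid_norm x)\<^sup>2" by (simp add: power_mult_distrib)
  finally have "euclid_norm (A *\<^sub>v x) \<le> c * euclid_norm x"
    by (rule power2_le_imp_le) (simp add: c euclid_norm_def)
  also have "\<dots> \<le> c" using c nx by (simp add: mult_left_le)
  finally show "euclid_norm (A *\<^sub>v x) \<le> c" .
qed

section \<open>Orthogonality of the Walsh matrix\<close>

lemma walsh_carrier: "walsh r \<in> carrier_mat (2 ^ r) (2 ^ r)"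
proof (induction r)
  case (Suc r)
  then have "four_block_mat (walsh r) (walsh r) (walsh r) (- walsh r) \<in> carrier_mat (2 ^ r + 2 ^ r) (2 ^ r + 2 ^ r)"
    by (intro four_block_carrier_mat) auto
  then show ?case by (simp add: mult_2)
qed simp

text \<open>Every column of the doubled matrix is a column of the smaller one stacked on plus or minus
  itself. The inner product of two columns is therefore the smaller inner product times
  \<open>1 + \<sigma>\<^sub>i \<sigma>\<^sub>j\<close>, which vanishes exactly when the two columns come from different halves.\<close>

lemma walsh_cols_orthogonal:
  assumes "i < 2 ^ r" "j < 2 ^ r"
  shows "(\<Sum>l<2 ^ r. cnj (walsh r $$ (l, i)) * walsh r $$ (l, j)) = (if i = j then 2 ^ r else 0)"
  using assms
proof (induction r arbitrary: i j)
  case (Suc r)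
  let ?N = "2 ^ r :: nat" and ?W = "walsh r"
  define q where "q i = (if i < ?N then i else i - ?N)" for i
  define \<sigma> :: "nat \<Rightarrow> complex" where "\<sigma> i = (if i < ?N then 1 else - 1)" for i
  have dim: "dim_row ?W = ?N" "dim_col ?W = ?N" using walsh_carrier[of r] by auto
  (* Column i is column q i of the smaller matrix, on top of itself times the sign \<sigma> i. *)
  have top: "walsh (Suc r) $$ (l, i) = ?W $$ (l, q i)"
    and bot: "walsh (Suc r) $$ (?N + l, i) = \<sigma> i * ?W $$ (l, q i)"
    if "l < ?N" "i < 2 ^ Suc r" for l i
    using that by (auto simp: dim q_def \<sigma>_def)
  have q: "q i < ?N" "q j < ?N" using Suc.prems by (auto simp: q_def)
  have "(\<Sum>l<2 ^ Suc r. cnj (walsh (Suc r) $$ (l, i)) * walsh (Suc r) $$ (l, j))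
      = (\<Sum>l<?N. cnj (walsh (Suc r) $$ (l, i)) * walsh (Suc r) $$ (l, j))
      + (\<Sum>l<?N. cnj (walsh (Suc r) $$ (?N + l, i)) * walsh (Suc r) $$ (?N + l, j))"
    unfolding power_Suc mult_2 by (rule sum_lessThan_add)
  also have "\<dots> = (\<Sum>l<?N. cnj (?W $$ (l, q i)) * ?W $$ (l, q j))
      + (\<Sum>l<?N. \<sigma> i * \<sigma> j * (cnj (?W $$ (l, q i)) * ?W $$ (l, q j)))"
    using Suc.prems
    by (intro arg_cong2[where f = "(+)"] sum.cong refl)
       (simp_all only: top bot lessThan_iff, simp add: \<sigma>_def)
  also have "\<dots> = (1 + \<sigma> i * \<sigma> j) * (\<Sum>l<?N. cnj (?W $$ (l, q i)) * ?W $$ (l, q j))"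
    by (simp add: sum_distrib_left algebra_simps)
  also have "\<dots> = (1 + \<sigma> i * \<sigma> j) * (if q i = q j then 2 ^ r else 0)"
    using Suc.IH[OF q] by simp
  also have "\<dots> = (if i = j then 2 ^ Suc r else 0)"
    using Suc.prems by (auto simp: q_def \<sigma>_def)
  finally show ?case .
qed simp

section \<open>Sums of fewer than \<open>m\<close> rank-one matrices\<close>

text \<open>A homogeneous linear system with fewer equations than unknowns has a nonzero solution: padded
  to a square matrix that has a zero row, its determinant vanishes.\<close>

lemma ex_nonzero_solution:
  fixes f :: "'a \<Rightarrow> nat \<Rightarrow> 'b::field"
  assumes "finite J" "card J < m"
  shows "\<exists>x\<in>carrier_vec m. x \<noteq> 0\<^sub>v m \<and> (\<forall>q\<in>J. (\<Sum>j<m. f q j * x $ j) = 0)"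
proof -
  obtain g where g: "bij_betw g {0..<card J} J"
    using ex_bij_betw_nat_finite[OF assms(1)] by blast
  (* Rows 0, ..., card J - 1 carry the equations; row card J is the zero row that forces det B = 0,
     and any later row is an arbitrary additional equation. *)
  define B where "B = mat\<^sub>r m m (\<lambda>i. if i = card J then 0\<^sub>v m else vec m (f (g i)))"
  have B: "B \<in> carrier_mat m m" by (simp add: B_def)
  have "det B = 0"
    unfolding B_def using assms(2) by (intro det_row_0) auto
  then obtain x where x: "x \<in> carrier_vec m" "x \<noteq> 0\<^sub>v m" "B *\<^sub>v x = 0\<^sub>v m"
    using det_0_iff_vec_prod_zero_field[OF B] by blast
  have "(\<Sum>j<m. f q j * x $ j) = 0" if "q \<in> J" for q
  proof -
    have "q \<in> g ` {0..<card J}" using bij_betw_imp_surj_on[OF g] that by simp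
    then obtain i where i: "i < card J" "q = g i" by auto
    then have "(B *\<^sub>v x) $ i = (\<Sum>j<m. f q j * x $ j)"
      using B x(1) assms(2) by (subst index_mult_mat_vec_sum) (auto simp: B_def)
    then show ?thesis using x(3) i assms(2) by simp
  qed
  with x show ?thesis by blast
qed

lemma finsum_mat_carrier:
  fixes F :: "'b \<Rightarrow> 'a::comm_ring_1 mat"
  assumes "\<And>q. q \<in> J \<Longrightarrow> F q \<in> carrier_mat nr nc"
  shows "finsum (module_mat TYPE('a) nr nc) F J \<in> carrier_mat nr nc"
proof -
  interpret M: abelian_group "module_mat TYPE('a) nr nc" by (rule abelian_group_mat)
  show ?thesis
    using M.finsum_closed[of F J] assms by (auto simp: module_mat_simps)
qed

lemma index_finsum_mat:
  fixes F :: "'b \<Rightarrow> 'a::comm_ring_1 mat"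
  assumes "finite J" "\<And>q. q \<in> J \<Longrightarrow> F q \<in> carrier_mat nr nc" "i < nr" "j < nc"
  shows "finsum (module_mat TYPE('a) nr nc) F J $$ (i, j) = (\<Sum>q\<in>J. F q $$ (i, j))"
  using assms(1,2)
proof (induction J rule: finite_induct)
  case empty
  interpret M: abelian_group "module_mat TYPE('a) nr nc" by (rule abelian_group_mat)
  show ?case using assms(3,4) by (simp add: module_mat_simps)
next
  case (insert q J)
  interpret M: abelian_group "module_mat TYPE('a) nr nc" by (rule abelian_group_mat)
  have "finsum (module_mat TYPE('a) nr nc) F J \<in> carrier_mat nr nc"
    using insert.prems by (intro finsum_mat_carrier) auto
  then show ?case
    using insert assms(3,4) by (subst M.finsum_insert) (auto simp: module_mat_simps)
qed

text \<open>Fewer than \<open>m\<close> rank-one matrices in dimension \<open>m\<close> have a common kernel vector. It is an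
  eigenvector of their sum minus \<open>c I\<close> for the eigenvalue \<open>- c\<close>. Of two parts of a
  family with fewer than \<open>2 m\<close> vectors at least one is that small, which with \<open>c = 1/2\<close> makes the
  error \<open>1/2\<close> optimal.\<close>

lemma spectral_norm_few_outer_prods_minus_scalar_ge:
  fixes v :: "'a \<Rightarrow> complex vec"
  assumes "finite J" "card J < m" and v: "\<And>q. q \<in> J \<Longrightarrow> v q \<in> carrier_vec m"
  shows "cmod c \<le> spectral_norm
    (finsum (module_mat TYPE(complex) m m) (\<lambda>q. outer_prod (v q) (v q)) J - c \<cdot>\<^sub>m 1\<^sub>m m)"
proof -
  let ?S = "finsum (module_mat TYPE(complex) m m) (\<lambda>q. outer_prod (v q) (v q)) J"
  obtain x where x: "x \<in> carrier_vec m" "x \<noteq> 0\<^sub>v m"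
    and orth: "\<And>q. q \<in> J \<Longrightarrow> (\<Sum>j<m. cnj (v q $ j) * x $ j) = 0"
    using ex_nonzero_solution[OF assms(1,2), of "\<lambda>q j. cnj (v q $ j)"] by blast
  have op: "outer_prod (v q) (v q) \<in> carrier_mat m m" if "q \<in> J" for q
    using v[OF that] by (auto simp: outer_prod_def)
  have S: "?S \<in> carrier_mat m m" by (rule finsum_mat_carrier) (rule op)
  have "(?S - c \<cdot>\<^sub>m 1\<^sub>m m) *\<^sub>v x = (- c) \<cdot>\<^sub>v x"
  proof (rule eq_vecI)
    fix i assume "i < dim_vec ((- c) \<cdot>\<^sub>v x)"
    then have i: "i < m" using x(1) by simp
    have entry: "?S $$ (i, j) = (\<Sum>q\<in>J. v q $ i * cnj (v q $ j))" if "j < m" for j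
      using i that
      by (subst index_finsum_mat[OF assms(1) op])
         (auto simp: outer_prod_def carrier_vecD[OF v] intro!: sum.cong)
    have "(\<Sum>j<m. ?S $$ (i, j) * x $ j) = (\<Sum>j<m. \<Sum>q\<in>J. v q $ i * (cnj (v q $ j) * x $ j))"
      by (intro sum.cong refl) (simp add: entry sum_distrib_right mult.assoc)
    also have "\<dots> = (\<Sum>q\<in>J. v q $ i * (\<Sum>j<m. cnj (v q $ j) * x $ j))"
      by (subst sum.swap) (simp add: sum_distrib_left)
    also have "\<dots> = 0" by (simp add: orth)
    finally have "(\<Sum>j<m. ?S $$ (i, j) * x $ j) = 0" .
    moreover have "((?S - c \<cdot>\<^sub>m 1\<^sub>m m) *\<^sub>v x) $ i
        = (\<Sum>j<m. ?S $$ (i, j) * x $ j - (if j = i then c * x $ j else 0))"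
      using S i x(1)
      by (subst index_mult_mat_vec_sum) (auto simp: left_diff_distrib intro!: sum.cong)
    ultimately show "((?S - c \<cdot>\<^sub>m 1\<^sub>m m) *\<^sub>v x) $ i = ((- c) \<cdot>\<^sub>v x) $ i"
      using i x(1) by (simp add: sum_subtractf)
  qed (use S x(1) in auto)
  then have "cmod (- c) \<le> spectral_norm (?S - c \<cdot>\<^sub>m 1\<^sub>m m)"
    using S x by (intro eigenvalue_le_spectral_norm) auto
  then show ?thesis by simp
qed

section \<open>Identity blocks coupled by a selection of unit vectors\<close>

definition selection_mat :: "nat \<Rightarrow> nat \<Rightarrow> (nat \<Rightarrow> nat) \<Rightarrow> complex mat" where
  "selection_mat h s k = mat_of_cols h (map (\<lambda>j. unit_vec h (k j)) [0..<s])"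

text \<open>Both \<open>V\<^sub>a V\<^sub>a\<^sup>*\<close>, \<open>V\<^sub>b V\<^sub>b\<^sup>*\<close> and their deviations from \<open>I/2\<close> have this form, with \<open>d = 1/2\<close> or
  \<open>d = 0\<close> on the diagonal and \<open>c = 1/2\<close> or \<open>c = -1/2\<close> in the coupling blocks; the selection matrix
  is \<open>\<Delta>\<close>.\<close>

definition coupling_mat :: "nat \<Rightarrow> nat \<Rightarrow> (nat \<Rightarrow> nat) \<Rightarrow> complex \<Rightarrow> complex \<Rightarrow> complex mat" where
  "coupling_mat h s k d c =
     four_block_mat (d \<cdot>\<^sub>m 1\<^sub>m h) (c \<cdot>\<^sub>m selection_mat h s k)
                    (c \<cdot>\<^sub>m mat_adjoint (selection_mat h s k)) (d \<cdot>\<^sub>m 1\<^sub>m s)"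

context
  fixes h s :: nat and k :: "nat \<Rightarrow> nat"
  assumes k_inj: "inj_on k {..<s}" and k_less: "\<And>p. p < s \<Longrightarrow> k p < h"
begin

lemma dim_selection_mat: "dim_row (selection_mat h s k) = h" "dim_col (selection_mat h s k) = s"
  by (simp_all add: selection_mat_def)

lemma index_selection_mat:
  "i < h \<Longrightarrow> p < s \<Longrightarrow> selection_mat h s k $$ (i, p) = (if i = k p then 1 else 0)"
  using k_less by (auto simp: selection_mat_def mat_of_cols_index)

lemma k_eq_iff: "p < s \<Longrightarrow> q < s \<Longrightarrow> k p = k q \<longleftrightarrow> p = q"
  using k_inj by (auto dest: inj_onD)

lemma dim_coupling_mat:
  "dim_row (coupling_mat h s k d c) = h + s" "dim_col (coupling_mat h s k d c) = h + s"
  by (simp_all add: coupling_mat_def)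

lemma index_coupling_mat:
  "i < h \<Longrightarrow> j < h \<Longrightarrow> coupling_mat h s k d c $$ (i, j) = (if i = j then d else 0)"
  "i < h \<Longrightarrow> q < s \<Longrightarrow> coupling_mat h s k d c $$ (i, h + q) = (if i = k q then c else 0)"
  "p < s \<Longrightarrow> j < h \<Longrightarrow> coupling_mat h s k d c $$ (h + p, j) = (if j = k p then c else 0)"
  "p < s \<Longrightarrow> q < s \<Longrightarrow> coupling_mat h s k d c $$ (h + p, h + q) = (if p = q then d else 0)"
  by (simp_all add: coupling_mat_def dim_selection_mat index_selection_mat)

lemma index_split:
  assumes "i < h + s"
  obtains "i < h" | p where "p < s" "i = h + p"
  using assms by (metis add_less_cancel_left le_Suc_ex not_le)

lemma mat_eq_coupling_matI:
  assumes "dim_row A = h + s" "dim_col A = h + s"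
    and "\<And>i j. i < h \<Longrightarrow> j < h \<Longrightarrow> A $$ (i, j) = (if i = j then d else 0)"
    and "\<And>i q. i < h \<Longrightarrow> q < s \<Longrightarrow> A $$ (i, h + q) = (if i = k q then c else 0)"
    and "\<And>p j. p < s \<Longrightarrow> j < h \<Longrightarrow> A $$ (h + p, j) = (if j = k p then c else 0)"
    and "\<And>p q. p < s \<Longrightarrow> q < s \<Longrightarrow> A $$ (h + p, h + q) = (if p = q then d else 0)"
  shows "A = coupling_mat h s k d c"
proof (rule eq_matI)
  fix i j assume "i < dim_row (coupling_mat h s k d c)" "j < dim_col (coupling_mat h s k d c)"
  then have "i < h + s" "j < h + s" by (simp_all add: dim_coupling_mat)
  then show "A $$ (i, j) = coupling_mat h s k d c $$ (i, j)"
    by (elim index_split) (simp_all add: assms(3-6) index_coupling_mat)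
qed (simp_all add: assms dim_coupling_mat)

lemma coupling_mat_minus_smult_one:
  "coupling_mat h s k d c - e \<cdot>\<^sub>m 1\<^sub>m (h + s) = coupling_mat h s k (d - e) c"
  by (rule mat_eq_coupling_matI)
     (auto simp: dim_coupling_mat index_coupling_mat)

lemma coupling_mat_add_opposite:
  "coupling_mat h s k d c + coupling_mat h s k d (- c) = (2 * d) \<cdot>\<^sub>m 1\<^sub>m (h + s)"
proof (rule eq_matI)
  fix i j assume "i < dim_row ((2 * d) \<cdot>\<^sub>m 1\<^sub>m (h + s) :: complex mat)"
    "j < dim_col ((2 * d) \<cdot>\<^sub>m 1\<^sub>m (h + s) :: complex mat)"
  then have "i < h + s" "j < h + s" by simp_all
  then show "(coupling_mat h s k d c + coupling_mat h s k d (- c)) $$ (i, j)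
      = ((2 * d) \<cdot>\<^sub>m 1\<^sub>m (h + s)) $$ (i, j)"
    by (elim index_split) (auto simp: dim_coupling_mat index_coupling_mat)
qed (simp_all add: dim_coupling_mat)

text \<open>A row of \<open>selection_mat\<close> has at most one nonzero entry, because no index is selected twice.\<close>

lemma sum_selected_le:
  assumes "0 \<le> (x :: real)"
  shows "(\<Sum>q<s. if i = k q then x else 0) \<le> x"
proof (cases "\<exists>p<s. i = k p")
  case True
  then obtain p where "p < s" "i = k p" by blast
  then have "(\<Sum>q<s. if i = k q then x else 0) = (\<Sum>q<s. if q = p then x else 0)"
    by (intro sum.cong) (auto simp: k_eq_iff)
  then show ?thesis using \<open>p < s\<close> by simp
next
  case False
  then have "(\<Sum>q<s. if i = k q then x else 0) = 0" by (intro sum.neutral) auto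
  then show ?thesis using assms by simp
qed

lemma spectral_norm_coupling_mat_le:
  "spectral_norm (coupling_mat h s k d c) \<le> cmod d + cmod c"
proof (rule spectral_norm_le_Schur; (simp only: dim_coupling_mat)?)
  fix i assume "i < h + s"
  then show "(\<Sum>j<h + s. cmod (coupling_mat h s k d c $$ (i, j))) \<le> cmod d + cmod c"
    using sum_selected_le[of "cmod c"]
    by (elim index_split)
       (simp_all add: sum_lessThan_add index_coupling_mat if_distrib[of cmod] k_less cong: if_cong)
next
  fix j assume "j < h + s"
  then show "(\<Sum>i<h + s. cmod (coupling_mat h s k d c $$ (i, j))) \<le> cmod d + cmod c"
    using sum_selected_le[of "cmod c"]
    by (elim index_split)
       (simp_all add: sum_lessThan_add index_coupling_mat if_distrib[of cmod] k_less cong: if_cong)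
qed simp

text \<open>Each row and each column has the diagonal entry and at most one further entry, so the Schur test
  gives the upper bound. For the lower bound, the matrix couples the unit vector with index \<open>k 0\<close> to
  the one with index \<open>h\<close>, the first of the second block; on their span it is the two by two matrix
  with diagonal \<open>d\<close> and off-diagonal \<open>\<epsilon> c\<close>, which has the eigenvalue \<open>d + c\<close>.\<close>

lemma spectral_norm_coupling_mat:
  assumes "0 < s" "0 \<le> d" "0 \<le> c" and \<epsilon>: "\<epsilon> = 1 \<or> \<epsilon> = - 1"
  shows "spectral_norm (coupling_mat h s k (of_real d) (\<epsilon> * of_real c)) = d + c"
proof (rule antisym)
  let ?M = "coupling_mat h s k (of_real d) (\<epsilon> * of_real c)"
  show "spectral_norm ?M \<le> d + c"
    using spectral_norm_coupling_mat_le[of "of_real d" "\<epsilon> * of_real c"] assms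
    by (auto simp: norm_mult)
  define x :: "complex vec"
    where "x = vec (h + s) (\<lambda>i. if i = k 0 then 1 else if i = h then \<epsilon> else 0)"
  have x: "x \<in> carrier_vec (h + s)" by (simp add: x_def)
  have x_top: "x $ i = (if i = k 0 then 1 else 0)" if "i < h" for i
    using that by (simp add: x_def)
  have x_bot: "x $ (h + p) = (if p = 0 then \<epsilon> else 0)" if "p < s" for p
    using that k_less[of 0] by (auto simp: x_def)
  have "x $ k 0 = 1" using k_less[OF assms(1)] by (simp add: x_top)
  then have "x \<noteq> 0\<^sub>v (h + s)" using k_less[OF assms(1)] by auto
  have "?M *\<^sub>v x = of_real (d + c) \<cdot>\<^sub>v x"
  proof (rule eq_vecI)
    fix i assume "i < dim_vec (of_real (d + c) \<cdot>\<^sub>v x)"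
    then have i: "i < h + s" using x by simp
    then have "(?M *\<^sub>v x) $ i = (\<Sum>j<h. ?M $$ (i, j) * x $ j) + (\<Sum>q<s. ?M $$ (i, h + q) * x $ (h + q))"
      using x by (subst index_mult_mat_vec_sum) (simp_all add: dim_coupling_mat sum_lessThan_add)
    also have "\<dots> = (\<Sum>j<h. if j = k 0 then ?M $$ (i, j) else 0)
        + (\<Sum>q<s. if q = 0 then ?M $$ (i, h + q) * \<epsilon> else 0)"
      by (intro arg_cong2[where f = "(+)"] sum.cong) (auto simp: x_top x_bot)
    also have "\<dots> = ?M $$ (i, k 0) + ?M $$ (i, h + 0) * \<epsilon>"
      using k_less[OF assms(1)] assms(1) by simp
    also have "\<dots> = of_real (d + c) * x $ i"
      using i
    proof (cases rule: index_split)
      case 1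
      then show ?thesis
        unfolding index_coupling_mat(1)[OF 1 k_less[OF assms(1)]] index_coupling_mat(2)[OF 1 assms(1)]
        using \<epsilon> by (auto simp: x_top)
    next
      case (2 p)
      have "k 0 = k p \<longleftrightarrow> p = 0" using k_eq_iff[OF assms(1) 2(1)] by auto
      then show ?thesis
        unfolding 2(2) index_coupling_mat(3)[OF 2(1) k_less[OF assms(1)]]
          index_coupling_mat(4)[OF 2(1) assms(1)]
        using 2(1) by (auto simp: x_bot algebra_simps)
    qed
    finally show "(?M *\<^sub>v x) $ i = (of_real (d + c) \<cdot>\<^sub>v x) $ i" using i x by simp
  qed (use x in \<open>simp add: dim_coupling_mat\<close>)
  then have "cmod (of_real (d + c)) \<le> spectral_norm ?M"
    using x \<open>x \<noteq> 0\<^sub>v (h + s)\<close>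
    by (intro eigenvalue_le_spectral_norm) (auto simp: dim_coupling_mat)
  then show "d + c \<le> spectral_norm ?M"
    unfolding norm_of_real using assms(2,3) by simp
qed

text \<open>The diagonal has \<open>h + s\<close> entries \<open>d\<close>, and each of the two coupling blocks has \<open>s\<close> entries
  \<open>c\<close>, one for every selected index.\<close>

lemma frobenius_norm_coupling_mat:
  "frobenius_norm (coupling_mat h s k d c)
   = sqrt (real (h + s) * (cmod d)\<^sup>2 + 2 * real s * (cmod c)\<^sup>2)"
proof -
  let ?a = "\<lambda>i j. (cmod (coupling_mat h s k d c $$ (i, j)))\<^sup>2"
  have "(\<Sum>i<h. \<Sum>j<h. ?a i j) = (\<Sum>i<h. \<Sum>j<h. if j = i then (cmod d)\<^sup>2 else 0)"
    by (intro sum.cong) (auto simp: index_coupling_mat)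
  moreover have "(\<Sum>i<h. \<Sum>q<s. ?a i (h + q)) = (\<Sum>q<s. \<Sum>i<h. if i = k q then (cmod c)\<^sup>2 else 0)"
    by (subst sum.swap, intro sum.cong) (auto simp: index_coupling_mat)
  moreover have "(\<Sum>p<s. \<Sum>j<h. ?a (h + p) j) = (\<Sum>p<s. \<Sum>j<h. if j = k p then (cmod c)\<^sup>2 else 0)"
    by (intro sum.cong) (auto simp: index_coupling_mat)
  moreover have "(\<Sum>p<s. \<Sum>q<s. ?a (h + p) (h + q)) = (\<Sum>p<s. \<Sum>q<s. if q = p then (cmod d)\<^sup>2 else 0)"
    by (intro sum.cong) (auto simp: index_coupling_mat)
  ultimately have "(\<Sum>i<h + s. \<Sum>j<h + s. ?a i j)
      = real (h + s) * (cmod d)\<^sup>2 + 2 * real s * (cmod c)\<^sup>2"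
    by (simp add: sum_lessThan_add sum.distrib k_less algebra_simps)
  then show ?thesis by (simp add: frobenius_norm_def dim_coupling_mat)
qed

text \<open>The entries of \<open>X X\<^sup>*\<close> are inner products of columns of the extended matrix, up to conjugation
  and the scaling \<open>1/(2 h)\<close>. Orthogonality makes such an inner product nonzero only between copies
  of the same column, where it is \<open>h\<close> times the signs of the two copies: the sign \<open>\<epsilon>\<close> cancels
  inside the second block and survives between a column and its repetition.\<close>

lemma Gram_extended_cols:
  fixes W :: "complex mat"
  assumes W: "W \<in> carrier_mat h h"
    and orth: "\<And>i j. i < h \<Longrightarrow> j < h \<Longrightarrow> (\<Sum>l<h. cnj (W $$ (l, i)) * W $$ (l, j)) = (if i = j then of_nat h else 0)"
    and \<epsilon>: "\<epsilon> = 1 \<or> \<epsilon> = - 1" and "0 < h"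
    and X: "X = complex_of_real (1 / sqrt (real (2 * h))) \<cdot>\<^sub>m
      mat_adjoint (mat_of_cols h (cols W @ map (\<lambda>j. \<epsilon> \<cdot>\<^sub>v col W (k j)) [0..<s]))"
  shows "X * mat_adjoint X = coupling_mat h s k (1/2) (\<epsilon> * (1/2))"
proof -
  define t where "t = complex_of_real (1 / sqrt (real (2 * h)))"
  have "t * t = complex_of_real (1 / real (2 * h))"
    unfolding t_def of_real_mult[symmetric] by simp
  then have t: "t * t = 1 / (2 * of_nat h)" "cnj t = t"
    by (simp_all add: t_def)
  have dX: "dim_row X = h + s" "dim_col X = h"
    using W by (simp_all add: X)
  have X_top: "X $$ (i, l) = t * cnj (W $$ (l, i))" if "i < h" "l < h" for i l
    using that W by (simp add: X t_def mat_of_cols_index nth_append)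
  have X_bot: "X $$ (h + p, l) = t * \<epsilon> * cnj (W $$ (l, k p))" if "p < s" "l < h" for p l
    using that W \<epsilon> k_less by (auto simp: X t_def mat_of_cols_index nth_append)
  have gram: "(\<Sum>l<h. (t * a * cnj (W $$ (l, i))) * cnj (t * b * cnj (W $$ (l, j))))
      = (if i = j then a * cnj b * (1/2) else 0)" if "i < h" "j < h" for i j a b
  proof -
    have "(\<Sum>l<h. (t * a * cnj (W $$ (l, i))) * cnj (t * b * cnj (W $$ (l, j))))
      = a * cnj b * (t * t) * (\<Sum>l<h. cnj (W $$ (l, i)) * W $$ (l, j))"
      by (simp add: sum_distrib_left t(2) mult_ac)
    then show ?thesis using orth[OF that] \<open>0 < h\<close> by (simp add: t(1))
  qed
  have \<epsilon>\<epsilon>: "cnj \<epsilon> = \<epsilon>" "\<epsilon> * \<epsilon> = 1" using \<epsilon> by auto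
  show ?thesis
  proof (rule mat_eq_coupling_matI)
    show "(X * mat_adjoint X) $$ (i, j) = (if i = j then 1/2 else 0)" if "i < h" "j < h" for i j
      using that gram[of i j 1 1] by (simp add: index_mult_adjoint dX X_top del: index_mult_mat)
    show "(X * mat_adjoint X) $$ (i, h + q) = (if i = k q then \<epsilon> * (1/2) else 0)"
      if "i < h" "q < s" for i q
      using that gram[of i "k q" 1 \<epsilon>] k_less
      by (simp add: index_mult_adjoint dX X_top X_bot \<epsilon>\<epsilon> del: index_mult_mat)
    show "(X * mat_adjoint X) $$ (h + p, j) = (if j = k p then \<epsilon> * (1/2) else 0)"
      if "p < s" "j < h" for p j
      using that gram[of "k p" j \<epsilon> 1] k_less
      by (simp add: index_mult_adjoint dX X_top X_bot \<epsilon>\<epsilon> eq_commute[of j] del: index_mult_mat)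
    show "(X * mat_adjoint X) $$ (h + p, h + q) = (if p = q then 1/2 else 0)"
      if "p < s" "q < s" for p q
      using that gram[of "k p" "k q" \<epsilon> \<epsilon>] k_less
      by (simp add: index_mult_adjoint dX X_bot \<epsilon>\<epsilon> k_eq_iff del: index_mult_mat)
  qed (simp_all add: dX)
qed

end

section \<open>The two halves of the frame\<close>

lemma mult_adjoint_append_cols:
  fixes A B :: "complex mat"
  assumes "A \<in> carrier_mat m a" "B \<in> carrier_mat m b"
    and V: "V = mat_of_cols m (cols A @ cols B)"
  shows "V * mat_adjoint V = A * mat_adjoint A + B * mat_adjoint B"
proof (rule eq_matI)
  fix i j assume "i < dim_row (A * mat_adjoint A + B * mat_adjoint B)"
    "j < dim_col (A * mat_adjoint A + B * mat_adjoint B)"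
  then have ij: "i < m" "j < m" using assms by auto
  have dV: "dim_row V = m" "dim_col V = a + b" using assms by auto
  have "V $$ (i, l) = A $$ (i, l)" if "i < m" "l < a" for i l
    using that assms(1,2) by (simp add: V mat_of_cols_index nth_append)
  moreover have "V $$ (i, a + l) = B $$ (i, l)" if "i < m" "l < b" for i l
    using that assms(1,2) by (simp add: V mat_of_cols_index nth_append)
  ultimately show "(V * mat_adjoint V) $$ (i, j) = (A * mat_adjoint A + B * mat_adjoint B) $$ (i, j)"
    using ij assms(1,2) dV
    by (simp add: index_mult_adjoint sum_lessThan_add del: index_mult_mat(1))
qed (use assms in auto)

lemma mat_adjoint_append_rows:
  fixes A B :: "complex mat"
  assumes "A \<in> carrier_mat a m" "B \<in> carrier_mat b m"
  shows "c \<cdot>\<^sub>m mat_adjoint (A @\<^sub>r B) = mat_of_cols m (cols (c \<cdot>\<^sub>m mat_adjoint A) @ cols (c \<cdot>\<^sub>m mat_adjoint B))"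
  by (rule eq_matI) (use assms in \<open>auto simp: append_rows_def mat_of_cols_index nth_append\<close>)

theorem theorem2p3:
  fixes r n m s :: nat
    and k :: "nat \<Rightarrow> nat"
    and Ya Yb Y V Va Vb \<Delta> :: "complex mat"
  assumes "0 < r" and "n = 2 ^ r"
    and "0 < m" and "n div 2 < m" and "m < n"
    and "s = m - n div 2"
    and "strict_mono_on {..<s} k" and "k ` {..<s} \<subseteq> {..<n div 2}"
    and "Ya = mat_of_cols (n div 2)
           (cols (walsh (r - 1)) @ map (\<lambda>j. col (walsh (r - 1)) (k j)) [0..<s])"
    and "Yb = mat_of_cols (n div 2)
           (cols (walsh (r - 1)) @ map (\<lambda>j. - col (walsh (r - 1)) (k j)) [0..<s])"
    and "Y = Ya @\<^sub>r Yb"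
    and "V = complex_of_real (1 / sqrt (real n)) \<cdot>\<^sub>m mat_adjoint Y"
    and "Va = complex_of_real (1 / sqrt (real n)) \<cdot>\<^sub>m mat_adjoint Ya"
    and "Vb = complex_of_real (1 / sqrt (real n)) \<cdot>\<^sub>m mat_adjoint Yb"
    and "\<Delta> = mat_of_cols (n div 2) (map (\<lambda>j. unit_vec (n div 2) (k j)) [0..<s])"
  shows "V = mat_of_cols m (cols Va @ cols Vb) \<and>
    V * mat_adjoint V = 1\<^sub>m m \<and>
    Va * mat_adjoint Va - (1/2) \<cdot>\<^sub>m 1\<^sub>m m =
           four_block_mat (0\<^sub>m (n div 2) (n div 2)) ((1/2) \<cdot>\<^sub>m \<Delta>)
                          ((1/2) \<cdot>\<^sub>m mat_adjoint \<Delta>) (0\<^sub>m s s) \<and>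
    Vb * mat_adjoint Vb - (1/2) \<cdot>\<^sub>m 1\<^sub>m m =
           four_block_mat (0\<^sub>m (n div 2) (n div 2)) (- ((1/2) \<cdot>\<^sub>m \<Delta>))
                          (- ((1/2) \<cdot>\<^sub>m mat_adjoint \<Delta>)) (0\<^sub>m s s) \<and>
    spectral_norm (Va * mat_adjoint Va - (1/2) \<cdot>\<^sub>m 1\<^sub>m m) = 1/2 \<and>
    spectral_norm (Vb * mat_adjoint Vb - (1/2) \<cdot>\<^sub>m 1\<^sub>m m) = 1/2 \<and>
    (\<forall>J1 J2. J1 \<union> J2 = {..<n} \<and> J1 \<inter> J2 = {} \<longrightarrow>
           max (spectral_norm ((\<Oplus>\<^bsub>module_mat TYPE(complex) m m\<^esub> j\<in>J1. outer_prod (col V j) (col V j))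
                                - (1/2) \<cdot>\<^sub>m 1\<^sub>m m))
               (spectral_norm ((\<Oplus>\<^bsub>module_mat TYPE(complex) m m\<^esub> j\<in>J2. outer_prod (col V j) (col V j))
                                - (1/2) \<cdot>\<^sub>m 1\<^sub>m m)) \<ge> 1/2) \<and>
    spectral_norm (Va * mat_adjoint Va) = 1 \<and>
    spectral_norm (Vb * mat_adjoint Vb) = 1 \<and>
    frobenius_norm (Va * mat_adjoint Va - (1/2) \<cdot>\<^sub>m 1\<^sub>m m) = sqrt (real s / 2) \<and>
    frobenius_norm (Vb * mat_adjoint Vb - (1/2) \<cdot>\<^sub>m 1\<^sub>m m) = sqrt (real s / 2) \<and>
    sqrt (real s / 2) = sqrt ((real m - real n / 2) / 2) \<and>
    frobenius_norm (Va * mat_adjoint Va) = sqrt ((real m + 2 * real s) / 4) \<and>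
    frobenius_norm (Vb * mat_adjoint Vb) = sqrt ((real m + 2 * real s) / 4) \<and>
    sqrt ((real m + 2 * real s) / 4) = sqrt ((3 * real m - real n) / 4)"
proof -
  define h where "h = n div 2"
  have h: "h = 2 ^ (r - 1)" and n: "n = 2 * h"
    using assms(1,2) by (cases r; simp add: h_def)+
  have h_pos: "0 < h" and s_pos: "0 < s" and m: "m = h + s"
    using assms(4,6) h by (simp_all add: h_def)
  have inj: "inj_on k {..<s}" using assms(7) by (rule strict_mono_on_imp_inj_on)
  have less: "k p < h" if "p < s" for p using assms(8) that by (auto simp: h_def)
  let ?W = "walsh (r - 1)" and ?M = "coupling_mat h s k"
  let ?cols = "\<lambda>\<epsilon>. cols ?W @ map (\<lambda>j. \<epsilon> \<cdot>\<^sub>v col ?W (k j)) [0..<s]"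
  have W: "?W \<in> carrier_mat h h" using walsh_carrier[of "r - 1"] by (simp add: h)
  have orth: "(\<Sum>l<h. cnj (?W $$ (l, i)) * ?W $$ (l, j)) = (if i = j then of_nat h else 0)"
    if "i < h" "j < h" for i j
    using walsh_cols_orthogonal[of i "r - 1" j] that by (simp add: h)
  have Ya: "Ya = mat_of_cols h (?cols 1)"
    using assms(9) by (simp add: h_def)
  have Yb: "Yb = mat_of_cols h (?cols (- 1))"
  proof -
    have "- col ?W (k j) = - 1 \<cdot>\<^sub>v col ?W (k j)" for j by (rule eq_vecI) auto
    then show ?thesis using assms(10) by (simp add: h_def)
  qed
  have dims: "Ya \<in> carrier_mat h m" "Yb \<in> carrier_mat h m"
    unfolding Ya Yb m using carrier_matD(2)[OF W] by (auto intro!: carrier_matI)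
  have \<Delta>: "\<Delta> = selection_mat h s k"
    using assms(15) by (simp add: selection_mat_def h_def)
  have Va: "Va * mat_adjoint Va = ?M (1/2) (1/2)"
    using Gram_extended_cols[OF inj less W orth _ h_pos, of 1 Va] assms(13)
    by (simp add: Ya n)
  have Vb: "Vb * mat_adjoint Vb = ?M (1/2) (- (1/2))"
    using Gram_extended_cols[OF inj less W orth _ h_pos, of "- 1" Vb] assms(14)
    by (simp add: Yb n)
  have Ea: "Va * mat_adjoint Va - (1/2) \<cdot>\<^sub>m 1\<^sub>m m = ?M 0 (1/2)"
    and Eb: "Vb * mat_adjoint Vb - (1/2) \<cdot>\<^sub>m 1\<^sub>m m = ?M 0 (- (1/2))"
    unfolding Va Vb m by (simp_all add: coupling_mat_minus_smult_one[OF inj less])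
  have V: "V = mat_of_cols m (cols Va @ cols Vb)"
    unfolding assms(11-14) by (rule mat_adjoint_append_rows[OF dims])
  have "Va \<in> carrier_mat m h" "Vb \<in> carrier_mat m h"
    using dims by (auto simp: assms(13,14))
  from mult_adjoint_append_cols[OF this V]
  have "V * mat_adjoint V = 1 \<cdot>\<^sub>m 1\<^sub>m m"
    using coupling_mat_add_opposite[OF inj less, of "1/2" "1/2"] by (simp add: Va Vb m)
  also have "\<dots> = 1\<^sub>m m" by (rule eq_matI) auto
  finally have frame: "V * mat_adjoint V = 1\<^sub>m m" .
  have dV: "V \<in> carrier_mat m n"
    using dims by (auto simp: assms(11,12) n append_rows_def)
  have blocks: "?M 0 c = four_block_mat (0\<^sub>m h h) (c \<cdot>\<^sub>m \<Delta>) (c \<cdot>\<^sub>m mat_adjoint \<Delta>) (0\<^sub>m s s)" for c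
    unfolding coupling_mat_def \<Delta>
    by (intro arg_cong2[where f = "\<lambda>A D. four_block_mat A _ _ D"] eq_matI) auto
  have neg: "(- (1/2)) \<cdot>\<^sub>m A = - ((1/2) \<cdot>\<^sub>m A)" for A :: "complex mat"
    by (rule eq_matI) auto
  have norm: "spectral_norm (?M 0 (1/2)) = 1/2" "spectral_norm (?M 0 (- (1/2))) = 1/2"
    "spectral_norm (?M (1/2) (1/2)) = 1" "spectral_norm (?M (1/2) (- (1/2))) = 1"
    using spectral_norm_coupling_mat[OF inj less s_pos, of 0 "1/2" 1]
      spectral_norm_coupling_mat[OF inj less s_pos, of 0 "1/2" "- 1"]
      spectral_norm_coupling_mat[OF inj less s_pos, of "1/2" "1/2" 1]
      spectral_norm_coupling_mat[OF inj less s_pos, of "1/2" "1/2" "- 1"]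
    by simp_all
  have frob: "frobenius_norm (?M 0 c) = sqrt (real s / 2)"
    "frobenius_norm (?M (1/2) c) = sqrt ((real m + 2 * real s) / 4)" if "cmod c = 1/2" for c
    by (simp_all add: frobenius_norm_coupling_mat[OF inj less] that m power_divide norm_divide
        field_simps)
  have lower: "1/2 \<le> max
      (spectral_norm ((\<Oplus>\<^bsub>module_mat TYPE(complex) m m\<^esub> j\<in>J1. outer_prod (col V j) (col V j))
        - (1/2) \<cdot>\<^sub>m 1\<^sub>m m))
      (spectral_norm ((\<Oplus>\<^bsub>module_mat TYPE(complex) m m\<^esub> j\<in>J2. outer_prod (col V j) (col V j))
        - (1/2) \<cdot>\<^sub>m 1\<^sub>m m))"
    if J: "J1 \<union> J2 = {..<n}" "J1 \<inter> J2 = {}" for J1 J2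
  proof -
    have fin: "finite J1" "finite J2" using J(1) by (metis finite_Un finite_lessThan)+
    have "card J1 + card J2 = n"
      using card_Un_disjoint[OF fin J(2)] J(1) by simp
    then have "card J1 < m \<or> card J2 < m" using n m s_pos by linarith
    moreover have "1/2 \<le> spectral_norm
        ((\<Oplus>\<^bsub>module_mat TYPE(complex) m m\<^esub> j\<in>J. outer_prod (col V j) (col V j)) - (1/2) \<cdot>\<^sub>m 1\<^sub>m m)"
      if "finite J" "card J < m" for J
      using spectral_norm_few_outer_prods_minus_scalar_ge[OF that, of "col V" "1/2"] dV
      by (auto simp: norm_divide)
    ultimately show ?thesis using fin by (auto simp: le_max_iff_disj)
  qed
  have sqrts: "sqrt (real s / 2) = sqrt ((real m - real n / 2) / 2)"
    "sqrt ((real m + 2 * real s) / 4) = sqrt ((3 * real m - real n) / 4)"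
    by (simp_all add: m n)
  have half: "cmod (1/2) = 1/2" "cmod (- (1/2)) = 1/2" by (simp_all add: norm_divide)
  show ?thesis
    unfolding Ea Eb h_def[symmetric] unfolding Va Vb
    by (intro conjI allI impI V frame blocks blocks[of "- (1/2)", unfolded neg] norm frob half
        lower sqrts) auto
qed

end
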